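(* Let $G$ be a graph and $R\subseteq V(G)$ with $|R|\ge 2$. If $G$ has an $R$-CIST of size $2$, then there is a directed $R$-minor of $G$ that has a CISA of size $2$.
   Context: Graphs are finite and connected, may have parallel edges but no loops. For a (directed or undirected) tree $T$, $\mathrm{int}(T)$ is the set of vertices of degree at least 2 in the underlying undirected tree and $L(T)$ the set of leaves. An $R$-Steiner tree is a subtree $T$ of $G$ with $R\subseteq V(T)$ and $L(T)\subseteq R$. An $R$-CIST of size $k$ is a set $\{T_1,\dots,T_k\}$ of $R$-Steiner trees such that for all distinct $u,v\in R$ and distinct $i,j$, the $(u,v)$-paths in $T_i$ and $T_j$ are edge-disjoint and internally vertex-disjoint. Directed $R$-minor: let $\mathcal P=\{V_1,\dots,V_{|R|}\}$ be a partition of $V(G)$ with $|V_i\cap R|=1$ and $G[V_i]$ connected for all $i$; the directed $R$-minor induced by $\mathcal P$ is the digraph with vertex set $\mathcal P$ in which there is an arc $(V_i,V_j)$ ($i\ne j$) for each edge of $G$ joining a vertex of $V_i$ to the terminal in $V_j$. An arborescence is a directed tree in which every vertex except the root (in-degree 0) has in-degree 1 in the tree. A CISA of size $k$ in a digraph $D$ is a set $\{T_1,\dots,T_k\}$ of spanning arborescences of $D$ with $\mathrm{int}(T_i)\cap\mathrm{int}(T_j)=\emptyset$ and $A(T_i)\cap A(T_j)=\emptyset$ for all distinct $i,j$. *)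

theory Defs
  imports "HOL-Library.Disjoint_Sets" "Graph_Theory.Digraph_Component"
begin

text \<open>
  Digraphs are those of the AFP entry \<^verbatim>\<open>Graph_Theory\<close> (parallel arcs are distinguishable elements
  of the arc type). That entry models undirected graphs as symmetric digraphs, where the
  two orientations of an edge form a cycle; undirected multigraphs and trees are therefore
  introduced separately here.
\<close>

record ('v, 'e) pre_multigraph =
  vertices :: "'v set"
  edges :: "'e set"
  ends :: "'e \<Rightarrow> 'v set"

text \<open>Every edge has exactly two ends: parallel edges are allowed, loops are not.\<close>

locale multigraph =
  fixes G :: "('v, 'e) pre_multigraph"
  assumes finite_vertices: "finite (vertices G)"
    and finite_edges: "finite (edges G)"
    and ends_subset: "e \<in> edges G \<Longrightarrow> ends G e \<subseteq> vertices G"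
    and card_ends: "e \<in> edges G \<Longrightarrow> card (ends G e) = 2"

text \<open>
  A walk from u is the list of its steps (edge, next vertex); its vertex sequence is
  \<^term>\<open>u # map snd p\<close> and its edge sequence is \<^term>\<open>map fst p\<close>.
\<close>

fun mg_walk :: "('v, 'e) pre_multigraph \<Rightarrow> 'v \<Rightarrow> ('e \<times> 'v) list \<Rightarrow> 'v \<Rightarrow> bool" where
  "mg_walk G u [] v \<longleftrightarrow> u \<in> vertices G \<and> u = v"
| "mg_walk G u ((e, w) # p) v \<longleftrightarrow>
     u \<in> vertices G \<and> e \<in> edges G \<and> ends G e = {u, w} \<and> mg_walk G w p v"

definition mg_path :: "('v, 'e) pre_multigraph \<Rightarrow> 'v \<Rightarrow> ('e \<times> 'v) list \<Rightarrow> 'v \<Rightarrow> bool" where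
  "mg_path G u p v \<longleftrightarrow> mg_walk G u p v \<and> distinct (u # map snd p)"

definition path_edges :: "('e \<times> 'v) list \<Rightarrow> 'e set" where
  "path_edges p = set (map fst p)"

definition path_inner :: "'v \<Rightarrow> ('e \<times> 'v) list \<Rightarrow> 'v \<Rightarrow> 'v set" where
  "path_inner u p v = set (u # map snd p) - {u, v}"

text \<open>
  Distinctness of the edges excludes going back and forth along one edge, while two
  parallel edges do form a cycle of length 2.
\<close>

definition mg_cycle :: "('v, 'e) pre_multigraph \<Rightarrow> 'v \<Rightarrow> ('e \<times> 'v) list \<Rightarrow> bool" where
  "mg_cycle G u p \<longleftrightarrow> mg_walk G u p u \<and> p \<noteq> [] \<and> distinct (map snd p) \<and> distinct (map fst p)"

definition mg_connected :: "('v, 'e) pre_multigraph \<Rightarrow> bool" where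
  "mg_connected G \<longleftrightarrow> vertices G \<noteq> {} \<and>
     (\<forall>u\<in>vertices G. \<forall>v\<in>vertices G. \<exists>p. mg_path G u p v)"

definition mg_tree :: "('v, 'e) pre_multigraph \<Rightarrow> bool" where
  "mg_tree T \<longleftrightarrow> multigraph T \<and> mg_connected T \<and> \<not> (\<exists>u p. mg_cycle T u p)"

definition mg_subgraph :: "('v, 'e) pre_multigraph \<Rightarrow> ('v, 'e) pre_multigraph \<Rightarrow> bool" where
  "mg_subgraph H G \<longleftrightarrow> multigraph H \<and> vertices H \<subseteq> vertices G \<and> edges H \<subseteq> edges G \<and>
     ends H = ends G"

definition mg_induced :: "('v, 'e) pre_multigraph \<Rightarrow> 'v set \<Rightarrow> ('v, 'e) pre_multigraph" where
  "mg_induced G X = \<lparr>vertices = X, edges = {e \<in> edges G. ends G e \<subseteq> X}, ends = ends G\<rparr>"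

definition mg_degree :: "('v, 'e) pre_multigraph \<Rightarrow> 'v \<Rightarrow> nat" where
  "mg_degree G v = card {e \<in> edges G. v \<in> ends G e}"

definition int_verts :: "('v, 'e) pre_multigraph \<Rightarrow> 'v set" where
  "int_verts T = {v \<in> vertices T. mg_degree T v \<ge> 2}"

definition leaves :: "('v, 'e) pre_multigraph \<Rightarrow> 'v set" where
  "leaves T = {v \<in> vertices T. mg_degree T v = 1}"

definition steiner_tree ::
    "('v, 'e) pre_multigraph \<Rightarrow> 'v set \<Rightarrow> ('v, 'e) pre_multigraph \<Rightarrow> bool" where
  "steiner_tree G R T \<longleftrightarrow> mg_tree T \<and> mg_subgraph T G \<and> R \<subseteq> vertices T \<and> leaves T \<subseteq> R"

definition CIST ::
    "('v, 'e) pre_multigraph \<Rightarrow> 'v set \<Rightarrow> ('v, 'e) pre_multigraph set \<Rightarrow> bool" where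
  "CIST G R \<T> \<longleftrightarrow> (\<forall>T\<in>\<T>. steiner_tree G R T) \<and>
     (\<forall>S\<in>\<T>. \<forall>T\<in>\<T>. S \<noteq> T \<longrightarrow>
        (\<forall>u\<in>R. \<forall>v\<in>R. u \<noteq> v \<longrightarrow>
          (\<forall>p q. mg_path S u p v \<longrightarrow> mg_path T u q v \<longrightarrow>
             path_edges p \<inter> path_edges q = {} \<and> path_inner u p v \<inter> path_inner u q v = {})))"

definition has_CIST :: "('v, 'e) pre_multigraph \<Rightarrow> 'v set \<Rightarrow> nat \<Rightarrow> bool" where
  "has_CIST G R k \<longleftrightarrow> (\<exists>\<T>. finite \<T> \<and> card \<T> = k \<and> CIST G R \<T>)"

definition minor_partition :: "('v, 'e) pre_multigraph \<Rightarrow> 'v set \<Rightarrow> 'v set set \<Rightarrow> bool" where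
  "minor_partition G R \<P> \<longleftrightarrow> partition_on (vertices G) \<P> \<and> card \<P> = card R \<and>
     (\<forall>X\<in>\<P>. card (X \<inter> R) = 1 \<and> mg_connected (mg_induced G X))"

text \<open>
  The arc (e, X, Y) goes from X to Y and stems from the edge e, so parallel arcs are kept.
  An edge between two terminals yields two opposite arcs.
\<close>

definition induced_directed_minor ::
    "('v, 'e) pre_multigraph \<Rightarrow> 'v set \<Rightarrow> 'v set set \<Rightarrow> ('v set, 'e \<times> 'v set \<times> 'v set) pre_digraph"
where
  "induced_directed_minor G R \<P> =
     \<lparr>verts = \<P>,
      arcs = {(e, X, Y). e \<in> edges G \<and> X \<in> \<P> \<and> Y \<in> \<P> \<and> X \<noteq> Y \<and>
                (\<exists>x\<in>X. \<exists>t\<in>Y \<inter> R. ends G e = {x, t})},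
      tail = (\<lambda>(e, X, Y). X),
      head = (\<lambda>(e, X, Y). Y)\<rparr>"

definition directed_minor ::
    "('v, 'e) pre_multigraph \<Rightarrow> 'v set \<Rightarrow> ('v set, 'e \<times> 'v set \<times> 'v set) pre_digraph \<Rightarrow> bool"
where
  "directed_minor G R D \<longleftrightarrow> (\<exists>\<P>. minor_partition G R \<P> \<and> D = induced_directed_minor G R \<P>)"

text \<open>Opposite arcs of a digraph become parallel edges of the underlying multigraph.\<close>

definition underlying :: "('v, 'a) pre_digraph \<Rightarrow> ('v, 'a) pre_multigraph" where
  "underlying D = \<lparr>vertices = verts D, edges = arcs D, ends = (\<lambda>a. {tail D a, head D a})\<rparr>"

definition arborescence :: "('v, 'a) pre_digraph \<Rightarrow> bool" where
  "arborescence A \<longleftrightarrow> mg_tree (underlying A) \<and>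
     (\<exists>r\<in>verts A. in_degree A r = 0 \<and> (\<forall>v\<in>verts A - {r}. in_degree A v = 1))"

definition CISA :: "('v, 'a) pre_digraph \<Rightarrow> ('v, 'a) pre_digraph set \<Rightarrow> bool" where
  "CISA D \<A> \<longleftrightarrow> (\<forall>A\<in>\<A>. arborescence A \<and> spanning A D) \<and>
     (\<forall>A\<in>\<A>. \<forall>B\<in>\<A>. A \<noteq> B \<longrightarrow>
        int_verts (underlying A) \<inter> int_verts (underlying B) = {} \<and> arcs A \<inter> arcs B = {})"

definition has_CISA :: "('v, 'a) pre_digraph \<Rightarrow> nat \<Rightarrow> bool" where
  "has_CISA D k \<longleftrightarrow> (\<exists>\<A>. finite \<A> \<and> card \<A> = k \<and> CISA D \<A>)"

end

(*
  Two completely independent Steiner trees T1, T2 are edge-disjoint and have disjoint interiors: a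
  common edge or inner vertex splits the terminals in both trees, and then some pair of terminals
  is split in both. Choose roots r1 \<noteq> r2 among the terminals, with r1 not inner in T2 and r2 not
  inner in T1. A nonterminal lies in at most one of the trees; send it to its nearest terminal
  ancestor there, and let the vertices outside both trees follow parent pointers in G. The fibres
  form the partition. In T_i every edge between two fibres joins a terminal to its parent, so it
  gives an arc into that terminal, and these arcs form an arborescence rooted at the fibre of r_i
  whose inner vertices are fibres of terminals that are inner in T_i or equal to r_i.
*)

theory Submission
  imports Defs
begin

section \<open>Walks\<close>

lemma mg_walk_vertices:
  assumes "mg_walk G u p v"
  shows "set (u # map snd p) \<subseteq> vertices G" "v \<in> set (u # map snd p)"
  using assms by (induction G u p v rule: mg_walk.induct) auto

lemma mg_walk_edges: "mg_walk G u p v \<Longrightarrow> set (map fst p) \<subseteq> edges G"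
  by (induction G u p v rule: mg_walk.induct) auto

lemma mg_walk_ends_subset:
  "mg_walk G u p v \<Longrightarrow> e \<in> set (map fst p) \<Longrightarrow> ends G e \<subseteq> set (u # map snd p)"
  by (induction G u p v rule: mg_walk.induct) auto

lemma mg_walk_append:
  "mg_walk G u (p @ q) v \<longleftrightarrow> (\<exists>w. mg_walk G u p w \<and> mg_walk G w q v)"
proof (induction p arbitrary: u)
  case Nil
  show ?case by (cases q) auto
next
  case (Cons a p)
  then show ?case by (cases a) auto
qed

lemma mg_walk_snoc:
  "mg_walk G u (p @ [(e, w)]) v \<longleftrightarrow>
     w = v \<and> v \<in> vertices G \<and> e \<in> edges G \<and> (\<exists>x. mg_walk G u p x \<and> ends G e = {x, v})"
  using mg_walk_vertices by (fastforce simp: mg_walk_append)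

lemma mg_walk_sym: "mg_walk G u p v \<Longrightarrow> \<exists>q. mg_walk G v q u"
proof (induction G u p v rule: mg_walk.induct)
  case (1 G u v)
  then have "mg_walk G v [] u" by auto
  then show ?case by blast
next
  case (2 G u e w p v)
  then obtain q where "mg_walk G v q w" by auto
  with 2(2) have "mg_walk G v (q @ [(e, u)]) u"
    by (auto simp: mg_walk_snoc insert_commute)
  then show ?case by blast
qed

lemma mg_walk_imp_path: "mg_walk G u p v \<Longrightarrow> \<exists>q. mg_path G u q v"
proof (induction G u p v rule: mg_walk.induct)
  case (1 G u v)
  then have "mg_path G u [] v" by (auto simp: mg_path_def)
  then show ?case by blast
next
  case (2 G u e w p v)
  then obtain q where q: "mg_path G w q v" by auto
  show ?case
  proof (cases "u \<in> set (w # map snd q)")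
    case False
    with q 2(2) have "mg_path G u ((e, w) # q) v" by (auto simp: mg_path_def)
    then show ?thesis by blast
  next
    case True
    show ?thesis
    proof (cases "u = w")
      case False
      with True obtain f where "(f, u) \<in> set q" by auto
      then obtain q1 q2 where "q = (q1 @ [(f, u)]) @ q2"
        by (metis append.assoc append_Cons append_Nil split_list)
      with q have "mg_path G u q2 v"
        unfolding mg_path_def mg_walk_append by (auto simp: mg_walk_append)
      then show ?thesis by blast
    qed (use q in blast)
  qed
qed

lemma mg_path_distinct_edges: "mg_path G u p v \<Longrightarrow> distinct (map fst p)"
proof (induction p arbitrary: u)
  case (Cons a p)
  obtain e w where a: "a = (e, w)" by force
  with Cons.prems have p: "mg_path G w p v" "u \<notin> set (w # map snd p)" "ends G e = {u, w}"
    by (auto simp: mg_path_def)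
  then have "e \<notin> set (map fst p)"
    using mg_walk_ends_subset[of G w p v e] by (auto simp: mg_path_def)
  with Cons.IH[OF p(1)] a show ?case by simp
qed simp

lemma mg_connectedI:
  assumes "r \<in> vertices G" "\<And>v. v \<in> vertices G \<Longrightarrow> \<exists>p. mg_walk G v p r"
  shows "mg_connected G"
  unfolding mg_connected_def
proof (intro conjI ballI)
  fix u v assume "u \<in> vertices G" "v \<in> vertices G"
  then obtain p q where "mg_walk G u p r" "mg_walk G r q v"
    using assms(2) mg_walk_sym by metis
  then have "mg_walk G u (p @ q) v" by (auto simp: mg_walk_append)
  then show "\<exists>p. mg_path G u p v" by (rule mg_walk_imp_path)
qed (use assms(1) in auto)

text \<open>Following \<open>par\<close> reaches \<open>r\<close> because \<open>d\<close> drops.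
  This serves trees with an edge deleted, rooted trees, and the fibres of the final
  partition.\<close>

lemma parent_walk:
  fixes d :: "'v \<Rightarrow> nat"
  assumes r: "r \<in> vertices G"
    and par: "\<And>v. v \<in> vertices G - {r} \<Longrightarrow> par v \<in> vertices G \<and> d (par v) < d v \<and>
           (\<exists>e\<in>edges G. ends G e = {v, par v})"
    and v: "v \<in> vertices G"
  shows "\<exists>p. mg_walk G v p r"
  using v
proof (induction "d v" arbitrary: v rule: less_induct)
  case less
  show ?case
  proof (cases "v = r")
    case True
    with r have "mg_walk G v [] r" by simp
    then show ?thesis by blast
  next
    case False
    with less.prems par obtain e where e: "par v \<in> vertices G" "d (par v) < d v"
        "e \<in> edges G" "ends G e = {v, par v}"
      by blast
    with less.hyps obtain p where "mg_walk G (par v) p r" by blast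
    with e less.prems have "mg_walk G v ((e, par v) # p) r" by simp
    then show ?thesis by blast
  qed
qed

text \<open>Breadth-first search: \<open>d\<close> is the distance from \<open>r\<close>, and the
  parent of \<open>v\<close> is the last vertex before \<open>v\<close> on a shortest walk from
  \<open>r\<close>.\<close>

lemma mg_connected_parents:
  assumes "mg_connected G" "r \<in> vertices G"
  shows "\<exists>par pe (d :: 'v \<Rightarrow> nat). \<forall>v\<in>vertices G - {r}. par v \<in> vertices G \<and>
    d (par v) < d v \<and> pe v \<in> edges G \<and> ends G (pe v) = {v, par v}"
proof -
  define d where "d v = (LEAST n. \<exists>p. length p = n \<and> mg_walk G r p v)" for v
  have "\<exists>x e. x \<in> vertices G \<and> d x < d v \<and> e \<in> edges G \<and> ends G e = {v, x}"
    if v: "v \<in> vertices G - {r}" for v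
  proof -
    have "\<exists>n p. length p = n \<and> mg_walk G r p v"
      using assms v by (auto simp: mg_connected_def mg_path_def)
    then have "\<exists>p. length p = d v \<and> mg_walk G r p v" unfolding d_def by (rule LeastI_ex)
    then obtain p where p: "length p = d v" "mg_walk G r p v" by blast
    with v have "p \<noteq> []" by auto
    then obtain q e w where pq: "p = q @ [(e, w)]" by (metis rev_exhaust surj_pair)
    with p obtain x where x: "mg_walk G r q x" "ends G e = {x, v}" "e \<in> edges G"
      by (auto simp: mg_walk_snoc)
    then have "d x \<le> length q" unfolding d_def by (intro Least_le) blast
    then have "d x < d v" using p pq by simp
    moreover have "x \<in> vertices G" using mg_walk_vertices[OF x(1)] by blast
    ultimately show ?thesis using x(2,3) by (metis insert_commute)
  qed
  then show ?thesis by metis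
qed

section \<open>Rooted trees\<close>

text \<open>A tree is encoded by parent pointers whose edges exhaust \<open>edges T\<close>. Any
  \<open>d\<close> that drops along \<open>par\<close> is allowed, not only the true depth, so a
  contracted tree can inherit the \<open>d\<close> of the original one.\<close>

locale rooted_tree = multigraph T for T :: "('v, 'e) pre_multigraph" +
  fixes r :: 'v and par :: "'v \<Rightarrow> 'v" and pe :: "'v \<Rightarrow> 'e" and d :: "'v \<Rightarrow> nat"
  assumes root: "r \<in> vertices T"
    and par_vertex: "v \<in> vertices T \<Longrightarrow> v \<noteq> r \<Longrightarrow> par v \<in> vertices T"
    and depth_par: "v \<in> vertices T \<Longrightarrow> v \<noteq> r \<Longrightarrow> d (par v) < d v"
    and ends_pe: "v \<in> vertices T \<Longrightarrow> v \<noteq> r \<Longrightarrow> ends T (pe v) = {v, par v}"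
    and edges_eq: "edges T = pe ` (vertices T - {r})"

text \<open>An edge that is no parent edge would close a cycle, since the parent edges alone already
  join its ends.\<close>

lemma mg_tree_rooted:
  assumes T: "mg_tree T" and r: "r \<in> vertices T"
  shows "\<exists>par pe d. rooted_tree T r par pe d"
proof -
  interpret multigraph T using T by (simp add: mg_tree_def)
  obtain par pe and d :: "'a \<Rightarrow> nat" where
    "\<forall>v\<in>vertices T - {r}. par v \<in> vertices T \<and> d (par v) < d v \<and>
        pe v \<in> edges T \<and> ends T (pe v) = {v, par v}"
    using T r mg_connected_parents[of T r] unfolding mg_tree_def by blast
  note P = bspec[OF this]
  have "e \<in> pe ` (vertices T - {r})" if e: "e \<in> edges T" for e
  proof (rule ccontr)
    assume ne: "e \<notin> pe ` (vertices T - {r})"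
    obtain x y where xy: "ends T e = {x, y}" "x \<noteq> y"
      using card_ends[OF e] by (auto simp: card_2_iff)
    then have V: "x \<in> vertices T" "y \<in> vertices T" using ends_subset[OF e] by auto
    let ?T' = "T\<lparr>edges := edges T - {e}\<rparr>"
    have "mg_connected ?T'"
    proof (rule mg_connectedI)
      show "r \<in> vertices ?T'" using r by simp
      show "\<exists>p. mg_walk ?T' v p r" if "v \<in> vertices ?T'" for v
      proof (rule parent_walk[where par = par and d = d])
        show "par v \<in> vertices ?T' \<and> d (par v) < d v \<and> (\<exists>e\<in>edges ?T'. ends ?T' e = {v, par v})"
          if "v \<in> vertices ?T' - {r}" for v
          using P[of v] that ne by auto
      qed (use r that in auto)
    qed
    then obtain p where p: "mg_path ?T' x p y" using V by (auto simp: mg_connected_def)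
    have sub: "mg_walk T u q v" if "mg_walk ?T' u q v" for u q v
      using that by (induction q arbitrary: u) auto
    have "e \<notin> set (map fst p)" using mg_walk_edges[of ?T' x p y] p by (auto simp: mg_path_def)
    moreover have "mg_walk T x (p @ [(e, x)]) x"
      using sub[of x p y] p e xy V by (auto simp: mg_walk_snoc mg_path_def insert_commute)
    ultimately have "mg_cycle T x (p @ [(e, x)])"
      using p mg_path_distinct_edges[OF p] by (auto simp: mg_cycle_def mg_path_def)
    with T show False by (auto simp: mg_tree_def)
  qed
  then have "edges T = pe ` (vertices T - {r})" using P by blast
  then have "rooted_tree T r par pe d"
    using P r by unfold_locales auto
  then show ?thesis by blast
qed

context rooted_tree
begin

lemma pe_edge: "v \<in> vertices T \<Longrightarrow> v \<noteq> r \<Longrightarrow> pe v \<in> edges T"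
  by (simp add: edges_eq)

lemma inj_on_pe: "inj_on pe (vertices T - {r})"
proof (rule inj_onI, rule ccontr)
  fix x y assume *: "x \<in> vertices T - {r}" "y \<in> vertices T - {r}" "pe x = pe y" "x \<noteq> y"
  then have "{x, par x} = {y, par y}" using ends_pe[of x] ends_pe[of y] by simp
  with *(4) have "par x = y" "par y = x" by (metis doubleton_eq_iff)+
  then show False using depth_par[of x] depth_par[of y] * by (metis DiffE insertI1 less_asym)
qed

lemma step_cases:
  assumes "e \<in> edges T" "ends T e = {u, w}"
  obtains (up) "u \<noteq> r" "u \<in> vertices T" "e = pe u" "par u = w"
    | (down) "w \<noteq> r" "w \<in> vertices T" "e = pe w" "par w = u"
proof -
  obtain c where c: "c \<in> vertices T" "c \<noteq> r" "e = pe c" using assms(1) edges_eq by auto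
  then have "{c, par c} = {u, w}" using assms(2) ends_pe by simp
  with c show ?thesis using up down by (auto simp: doubleton_eq_iff)
qed

text \<open>After a step from a parent to its child \<open>w\<close>, the only way up from
  \<open>w\<close> is \<open>pe w\<close> again, which distinctness forbids; so the walk keeps
  descending.\<close>

lemma walk_down:
  assumes "mg_walk T u p v" "distinct (map fst p)" "p \<noteq> []"
    and "fst (hd p) = pe (snd (hd p))" "snd (hd p) \<noteq> r" "par (snd (hd p)) = u"
  shows "d u < d v \<and> fst (last p) = pe v"
  using assms
proof (induction p arbitrary: u)
  case (Cons a p)
  obtain e w where a: "a = (e, w)" by force
  with Cons.prems have w: "mg_walk T w p v" "e = pe w" "w \<noteq> r" "par w = u"
    "e \<notin> set (map fst p)" "distinct (map fst p)"
    by auto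
  have wV: "w \<in> vertices T" using mg_walk_vertices[OF w(1)] by auto
  with w depth_par[of w] have less: "d u < d w" by simp
  show ?case
  proof (cases p)
    case Nil
    then show ?thesis using a w less by simp
  next
    case (Cons b q)
    obtain f x where b: "b = (f, x)" by force
    have f: "f \<in> edges T" "ends T f = {w, x}" "f \<noteq> e" using w Cons b by auto
    from f(1,2) show ?thesis
    proof (cases rule: step_cases)
      case up
      with f w show ?thesis by simp
    next
      case down
      with Cons.IH[OF w(1,6)] less show ?thesis using a Cons b by simp
    qed
  qed
qed simp

text \<open>Either every step goes up and \<open>d\<close> drops, or the first step down starts a
  descent as in \<open>walk_down\<close>.\<close>

lemma walk_last:
  assumes "mg_walk T u p v" "distinct (map fst p)" "p \<noteq> []"
  shows "fst (last p) = pe v \<or> d v < d u"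
  using assms
proof (induction p arbitrary: u)
  case (Cons a p)
  obtain e w where a: "a = (e, w)" by force
  with Cons.prems have w: "mg_walk T w p v" "e \<in> edges T" "ends T e = {u, w}" by auto
  from w(2,3) show ?case
  proof (cases rule: step_cases)
    case up
    then have "d w < d u" using depth_par by auto
    then show ?thesis using Cons.IH[OF w(1)] Cons.prems a w by (cases "p = []") auto
  next
    case down
    then show ?thesis using walk_down[OF Cons.prems] a by simp
  qed
qed simp

text \<open>
  A walk without repeated edges goes up and then down. Hence a closed one would start and end
  with the edge from its base point to the parent.
\<close>

lemma mg_tree: "mg_tree T"
  unfolding mg_tree_def
proof (intro conjI notI)
  show "multigraph T" by unfold_locales
  show "mg_connected T"
  proof (rule mg_connectedI[OF root])
    fix v assume "v \<in> vertices T"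
    then show "\<exists>p. mg_walk T v p r"
      by (rule parent_walk[OF root, of par d, rotated])
        (use par_vertex depth_par ends_pe pe_edge in blast)
  qed
  assume "\<exists>u p. mg_cycle T u p"
  then obtain u p where p: "mg_walk T u p u" "p \<noteq> []" "distinct (map fst p)"
    by (auto simp: mg_cycle_def)
  obtain e w q where q: "p = (e, w) # q" using p(2) by (metis list.exhaust surj_pair)
  with p have e: "e \<in> edges T" "ends T e = {u, w}" by auto
  from walk_last[OF p(1,3,2)] have last: "fst (last p) = pe u" by simp
  from e show False
  proof (cases rule: step_cases)
    case up
    \<comment> \<open>The first edge is \<open>pe u\<close> as well, so distinctness of the edges
      leaves a single step, which would be a loop.\<close>
    have "q = []"
      using last p(3) q up by (metis distinct.simps(2) last_ConsR last_in_set list.set_map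
          list.simps(9) image_eqI fst_conv)
    with p q have "u = w" by simp
    with card_ends[OF e(1)] e(2) show False by simp
  next
    case down
    with walk_down[OF p(1,3,2)] q show False by simp
  qed
qed

section \<open>Descendants and the cuts they define\<close>

definition below :: "'v \<Rightarrow> 'v set" where
  "below c = {x. (x, c) \<in> {(v, par v) | v. v \<in> vertices T \<and> v \<noteq> r}\<^sup>*}"

lemma below_self: "c \<in> below c"
  by (simp add: below_def)

text \<open>The excluded case \<open>v = c\<close> is the point: \<open>pe c\<close> is the only
  parent edge that can leave \<open>below c\<close>.\<close>

lemma below_par_iff:
  assumes "v \<in> vertices T" "v \<noteq> r" "v \<noteq> c"
  shows "v \<in> below c \<longleftrightarrow> par v \<in> below c"
proof
  assume "v \<in> below c"
  then show "par v \<in> below c"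
    using assms(3) unfolding below_def by (auto elim: converse_rtranclE)
next
  assume "par v \<in> below c"
  then show "v \<in> below c"
    using assms(1,2) unfolding below_def by (auto intro: converse_rtrancl_into_rtrancl)
qed

lemma below_depth:
  assumes "x \<in> below c" "x \<noteq> c"
  shows "x \<in> vertices T \<and> x \<noteq> r \<and> d c < d x"
proof -
  have "(x, c) \<in> {(v, par v) | v. v \<in> vertices T \<and> v \<noteq> r}\<^sup>*"
    using assms(1) by (simp add: below_def)
  then have "x = c \<or> x \<in> vertices T \<and> x \<noteq> r \<and> d c < d x"
  proof (induction rule: converse_rtrancl_induct)
    case (step y z)
    then show ?case using depth_par[of y] by auto
  qed simp
  with assms(2) show ?thesis by simp
qed

lemma below_vertices: "c \<in> vertices T \<Longrightarrow> below c \<subseteq> vertices T"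
  using below_depth by blast

text \<open>By \<open>below_par_iff\<close> only \<open>pe c\<close> can have exactly one end in
  \<open>below c\<close>, so a walk that changes sides uses it and meets
  \<open>par c\<close>.\<close>

lemma walk_crosses:
  assumes "mg_walk T u p v" "(u \<in> below c) \<noteq> (v \<in> below c)"
  shows "pe c \<in> path_edges p \<and> par c \<in> set (u # map snd p)"
  using assms
proof (induction p arbitrary: u)
  case (Cons a p)
  obtain e w where a: "a = (e, w)" by force
  with Cons.prems have w: "mg_walk T w p v" "e \<in> edges T" "ends T e = {u, w}" by auto
  show ?case
  proof (cases "(u \<in> below c) = (w \<in> below c)")
    case True
    then show ?thesis using Cons.IH[OF w(1)] Cons.prems a by (auto simp: path_edges_def)
  next
    case False
    from w(2,3) show ?thesis
    proof (cases rule: step_cases)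
      case up
      then show ?thesis using below_par_iff[of u c] False a by (auto simp: path_edges_def)
    next
      case down
      then show ?thesis using below_par_iff[of w c] False a by (auto simp: path_edges_def)
    qed
  qed
qed simp

text \<open>A vertex of \<open>below c\<close> with maximal \<open>d\<close> has no child, since a
  child would be a descendant of \<open>c\<close> with larger \<open>d\<close>; so its parent edge
  is its only edge.\<close>

lemma leaf_below:
  assumes c: "c \<in> vertices T" "c \<noteq> r"
  shows "\<exists>u \<in> leaves T. u \<in> below c"
proof -
  have fin: "finite (below c)"
    using below_vertices[OF c(1)] finite_vertices finite_subset by blast
  have "Max (d ` below c) \<in> d ` below c" using fin below_self by (intro Max_in) auto
  then obtain u where u: "u \<in> below c" "d u = Max (d ` below c)" by auto
  have max: "d x \<le> d u" if "x \<in> below c" for x using u(2) fin that by simp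
  have uV: "u \<in> vertices T" "u \<noteq> r"
    using below_depth u(1) c by blast+
  have "e = pe u" if e: "e \<in> edges T" "u \<in> ends T e" for e
  proof -
    obtain x where x: "x \<in> vertices T" "x \<noteq> r" "e = pe x" using e(1) edges_eq by auto
    then consider "x = u" | "par x = u" using e(2) ends_pe by auto
    then show ?thesis
    proof cases
      case 2
      then have "x \<in> below c"
        using u(1) below_par_iff[OF x(1,2)] below_self by (cases "x = c") auto
      with max[of x] 2 depth_par[OF x(1,2)] show ?thesis by simp
    qed (use x in simp)
  qed
  then have "{e \<in> edges T. u \<in> ends T e} = {pe u}"
    using pe_edge[OF uV] ends_pe[OF uV] by blast
  then have "u \<in> leaves T" using uV by (simp add: leaves_def mg_degree_def)
  with u(1) show ?thesis by blast
qed

lemma par_notin_below: "c \<in> vertices T \<Longrightarrow> c \<noteq> r \<Longrightarrow> par c \<notin> below c"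
  using below_depth[of "par c" c] depth_par[of c] by fastforce

lemma root_notin_below: "c \<noteq> r \<Longrightarrow> r \<notin> below c"
  using below_depth by blast

lemma card_incident_ge:
  assumes "{e1, e2} \<subseteq> {e \<in> edges T. v \<in> ends T e}"
  shows "card {e1, e2} \<le> mg_degree T v"
  unfolding mg_degree_def using assms finite_edges by (intro card_mono) auto

end

section \<open>Disjointness of completely independent Steiner trees\<close>

lemma steiner_treeD:
  assumes "steiner_tree G R T"
  shows "mg_tree T" "multigraph T" "mg_subgraph T G" "R \<subseteq> vertices T" "leaves T \<subseteq> R"
  using assms by (auto simp: steiner_tree_def mg_tree_def)

text \<open>\<open>D\<close> splits \<open>X\<close>, and every walk across the split has property
  \<open>P\<close>, later taken to be the use of a given edge or the visit of a given vertex.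
  \<open>P\<close> also takes the start \<open>u\<close>, which the step list of a walk does not
  record.\<close>

definition separation ::
    "('v, 'e) pre_multigraph \<Rightarrow> 'v set \<Rightarrow> ('v \<Rightarrow> ('e \<times> 'v) list \<Rightarrow> bool) \<Rightarrow> 'v set \<Rightarrow> bool" where
  "separation T X P D \<longleftrightarrow> X \<inter> D \<noteq> {} \<and> X - D \<noteq> {} \<and>
     (\<forall>u p v. mg_walk T u p v \<longrightarrow> (u \<in> D) \<noteq> (v \<in> D) \<longrightarrow> P u p)"

text \<open>With the tree rooted at a terminal and \<open>e = pe c\<close>, the set
  \<open>below c\<close> omits the root but contains a leaf, and leaves are terminals.\<close>

lemma steiner_edge_separates:
  assumes S: "steiner_tree G R S" and R: "R \<noteq> {}" and e: "e \<in> edges S"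
  shows "\<exists>D. separation S R (\<lambda>u p. e \<in> path_edges p) D"
proof -
  note S' = steiner_treeD[OF S]
  obtain r where r: "r \<in> R" using R by blast
  then obtain par pe d where "rooted_tree S r par pe d"
    using mg_tree_rooted S' by (metis subsetD)
  then interpret rooted_tree S r par pe d .
  obtain c where c: "c \<in> vertices S" "c \<noteq> r" "e = pe c" using e edges_eq by auto
  have "\<exists>u\<in>R. u \<in> below c" using leaf_below[OF c(1,2)] S'(5) by blast
  then show ?thesis
    using walk_crosses[of _ _ _ c] root_notin_below[OF c(2)] r c(3)
    unfolding separation_def by (intro exI[of _ "below c"]) blast
qed

text \<open>In the tree rooted at a terminal other than \<open>w\<close>, an inner \<open>w\<close>
  has a child \<open>c\<close>, and every walk entering or leaving \<open>below c\<close> visits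
  \<open>w = par c\<close>. Taking \<open>w\<close> out of the terminals makes it an internal vertex
  of the paths between a separated pair, never an end.\<close>

lemma steiner_vertex_separates:
  assumes S: "steiner_tree G R S" and R: "card R \<ge> 2" and w: "w \<in> int_verts S"
  shows "\<exists>D. separation S (R - {w}) (\<lambda>u p. w \<in> set (u # map snd p)) D"
proof -
  note S' = steiner_treeD[OF S]
  have "\<not> R \<subseteq> {w}" using R card_mono[of "{w}" R] by auto
  then obtain r where r: "r \<in> R" "r \<noteq> w" by blast
  then obtain par pe d where "rooted_tree S r par pe d"
    using mg_tree_rooted S' by (metis subsetD)
  then interpret rooted_tree S r par pe d .
  have "\<not> {e \<in> edges S. w \<in> ends S e} \<subseteq> {pe w}"
    using w card_mono[of "{pe w}" "{e \<in> edges S. w \<in> ends S e}"]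
    by (auto simp: int_verts_def mg_degree_def)
  then obtain c where c: "c \<in> vertices S" "c \<noteq> r" "w \<in> ends S (pe c)" "pe c \<noteq> pe w"
    using edges_eq by auto
  then have w: "w = par c" using ends_pe[OF c(1,2)] by auto
  obtain u where u: "u \<in> R" "u \<in> below c" using leaf_below[OF c(1,2)] S'(5) by blast
  then have "u \<noteq> w" using par_notin_below[OF c(1,2)] w by auto
  then show ?thesis
    using u walk_crosses[of _ _ _ c] root_notin_below[OF c(2)] r w
    unfolding separation_def by (intro exI[of _ "below c"]) blast
qed

text \<open>
  Restricted to X, both separations are non-constant 2-colourings, and two such colourings always
  have a common bichromatic pair. This turns the pairwise condition in the definition of a CIST
  into a condition on the whole trees.
\<close>

lemma common_separated_pair:
  assumes "separation S X P D" "separation T X Q D'"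
  shows "\<exists>u\<in>X. \<exists>v\<in>X. u \<noteq> v \<and>
    (\<forall>p q. mg_walk S u p v \<longrightarrow> mg_walk T u q v \<longrightarrow> P u p \<and> Q u q)"
proof -
  obtain a b where ab: "a \<in> X" "b \<in> X" "a \<in> D" "b \<notin> D"
    using assms(1) unfolding separation_def by blast
  obtain a' b' where ab': "a' \<in> X" "b' \<in> X" "a' \<in> D'" "b' \<notin> D'"
    using assms(2) unfolding separation_def by blast
  have "\<exists>u\<in>X. \<exists>v\<in>X. (u \<in> D) \<noteq> (v \<in> D) \<and> (u \<in> D') \<noteq> (v \<in> D')"
  \<comment> \<open>\<open>D\<close> splits \<open>a\<close> and \<open>b\<close>. If
    \<open>D'\<close> does not, a point \<open>c\<close> on the other side of \<open>D'\<close> is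
    split from both by \<open>D'\<close> and from one of them by \<open>D\<close>.\<close>
  proof (cases "(a \<in> D') = (b \<in> D')")
    case True
    then obtain c where "c \<in> X" "(c \<in> D') \<noteq> (a \<in> D')" using ab' by metis
    with True ab show ?thesis by (cases "c \<in> D") auto
  qed (use ab in auto)
  then obtain u v where uv: "u \<in> X" "v \<in> X" "(u \<in> D) \<noteq> (v \<in> D)" "(u \<in> D') \<noteq> (v \<in> D')" by blast
  then have "\<forall>p q. mg_walk S u p v \<longrightarrow> mg_walk T u q v \<longrightarrow> P u p \<and> Q u q"
    using assms unfolding separation_def by blast
  with uv show ?thesis by metis
qed

lemma steiner_path:
  assumes "steiner_tree G R T" "u \<in> R" "v \<in> R"
  obtains p where "mg_path T u p v"
proof -
  have "mg_connected T" "u \<in> vertices T" "v \<in> vertices T"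
    using assms steiner_treeD[OF assms(1)] by (auto simp: mg_tree_def)
  then show ?thesis using that unfolding mg_connected_def by blast
qed

lemma CIST_pairD:
  assumes "CIST G R {S, T}" "S \<noteq> T" "u \<in> R" "v \<in> R" "u \<noteq> v" "mg_path S u p v" "mg_path T u q v"
  shows "path_edges p \<inter> path_edges q = {}" "path_inner u p v \<inter> path_inner u q v = {}"
proof -
  have "S \<in> {S, T}" "T \<in> {S, T}" by simp_all
  then have "path_edges p \<inter> path_edges q = {} \<and> path_inner u p v \<inter> path_inner u q v = {}"
    using assms unfolding CIST_def by (metis (no_types))
  then show "path_edges p \<inter> path_edges q = {}" "path_inner u p v \<inter> path_inner u q v = {}"
    by blast+
qed

text \<open>A common edge separates terminals in both trees, and a pair separated in both has two
  paths through that edge.\<close>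

lemma CIST_edges_disjoint:
  assumes C: "CIST G R {S, T}" and ST: "S \<noteq> T" and R: "R \<noteq> {}"
  shows "edges S \<inter> edges T = {}"
proof (rule ccontr)
  have steiner: "steiner_tree G R S" "steiner_tree G R T" using C by (auto simp: CIST_def)
  assume "edges S \<inter> edges T \<noteq> {}"
  then obtain e where e: "e \<in> edges S" "e \<in> edges T" by blast
  obtain D D' where D: "separation S R (\<lambda>u p. e \<in> path_edges p) D"
    and D': "separation T R (\<lambda>u p. e \<in> path_edges p) D'"
    using steiner_edge_separates[OF steiner(1) R e(1)] steiner_edge_separates[OF steiner(2) R e(2)]
    by blast
  obtain u v where uv: "u \<in> R" "v \<in> R" "u \<noteq> v"
    and e': "\<And>p q. mg_walk S u p v \<Longrightarrow> mg_walk T u q v \<Longrightarrow> e \<in> path_edges p \<and> e \<in> path_edges q"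
    using common_separated_pair[OF D D'] by blast
  obtain p where p: "mg_path S u p v" by (rule steiner_path[OF steiner(1) uv(1,2)])
  obtain q where q: "mg_path T u q v" by (rule steiner_path[OF steiner(2) uv(1,2)])
  show False using e'[of p q] p q CIST_pairD(1)[OF C ST uv p q] by (auto simp: mg_path_def)
qed

lemma CIST_int_disjoint:
  assumes C: "CIST G R {S, T}" and ST: "S \<noteq> T" and R: "card R \<ge> 2"
  shows "int_verts S \<inter> int_verts T = {}"
proof (rule ccontr)
  have steiner: "steiner_tree G R S" "steiner_tree G R T" using C by (auto simp: CIST_def)
  assume "int_verts S \<inter> int_verts T \<noteq> {}"
  then obtain w where w: "w \<in> int_verts S" "w \<in> int_verts T" by blast
  obtain D D' where D: "separation S (R - {w}) (\<lambda>u p. w \<in> set (u # map snd p)) D"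
    and D': "separation T (R - {w}) (\<lambda>u p. w \<in> set (u # map snd p)) D'"
    using steiner_vertex_separates[OF steiner(1) R w(1)]
      steiner_vertex_separates[OF steiner(2) R w(2)]
    by blast
  obtain u v where uv: "u \<in> R - {w}" "v \<in> R - {w}" "u \<noteq> v"
    and w': "\<And>p q. mg_walk S u p v \<Longrightarrow> mg_walk T u q v \<Longrightarrow>
      w \<in> set (u # map snd p) \<and> w \<in> set (u # map snd q)"
    using common_separated_pair[OF D D'] by blast
  have uvR: "u \<in> R" "v \<in> R" using uv by auto
  obtain p where p: "mg_path S u p v" by (rule steiner_path[OF steiner(1) uvR])
  obtain q where q: "mg_path T u q v" by (rule steiner_path[OF steiner(2) uvR])
  \<comment> \<open>Both ends come from \<open>R - {w}\<close>, so \<open>w\<close> is internal on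
    both paths.\<close>
  have "w \<in> path_inner u p v \<inter> path_inner u q v"
    using w'[of p q] p q uv(1,2) by (auto simp: mg_path_def path_inner_def)
  with CIST_pairD(2)[OF C ST uvR uv(3) p q] show False by blast
qed

text \<open>Degree 0 is excluded by the parent edge, degree 1 because leaves are terminals. With
  disjoint interiors, the two trees can then share only terminals.\<close>

lemma steiner_nonterminal_int:
  assumes S: "steiner_tree G R S" and R: "R \<noteq> {}" and v: "v \<in> vertices S" "v \<notin> R"
  shows "v \<in> int_verts S"
proof -
  note S' = steiner_treeD[OF S]
  obtain r where r: "r \<in> R" using R by blast
  then obtain par pe d where "rooted_tree S r par pe d"
    using mg_tree_rooted S' by (metis subsetD)
  then interpret rooted_tree S r par pe d .
  have "v \<noteq> r" using r v by auto
  then have "pe v \<in> {e \<in> edges S. v \<in> ends S e}" using pe_edge ends_pe v by simp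
  then have "mg_degree S v \<noteq> 0" using finite_edges by (auto simp: mg_degree_def)
  moreover have "mg_degree S v \<noteq> 1" using S'(5) v by (auto simp: leaves_def)
  ultimately show ?thesis using v by (simp add: int_verts_def)
qed

text \<open>In the tree rooted at \<open>z\<close>, a leaf below any other vertex is not the root.
  The free choice of \<open>z\<close> later keeps the two roots apart.\<close>

lemma steiner_other_leaf:
  assumes S: "steiner_tree G R S" and R: "card R \<ge> 2" and z: "z \<in> vertices S"
  shows "\<exists>t\<in>R - int_verts S. t \<noteq> z"
proof -
  note S' = steiner_treeD[OF S]
  obtain par pe d where "rooted_tree S z par pe d"
    using mg_tree_rooted[OF S'(1) z] by blast
  then interpret rooted_tree S z par pe d .
  have "\<not> R \<subseteq> {z}" using R card_mono[of "{z}" R] by auto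
  then obtain c where "c \<in> vertices S" "c \<noteq> z" using S'(4) by blast
  then obtain u where "u \<in> leaves S" "u \<noteq> z"
    using leaf_below[of c] root_notin_below[of c] by blast
  then show ?thesis using S'(5) by (auto simp: leaves_def int_verts_def)
qed

section \<open>Contracting every vertex to a terminal\<close>

definition fibre :: "('v, 'e) pre_multigraph \<Rightarrow> ('v \<Rightarrow> 'v) \<Rightarrow> 'v \<Rightarrow> 'v set" where
  "fibre G f t = {v \<in> vertices G. f v = t}"

text \<open>\<open>f v\<close> is the first terminal among \<open>v\<close>, \<open>p v\<close>,
  \<open>p (p v)\<close> and so on; one is reached because \<open>m\<close> drops.\<close>

lemma exists_projection:
  fixes m :: "'v \<Rightarrow> nat"
  assumes p: "\<And>v. v \<in> V - R \<Longrightarrow> p v \<in> V \<and> m (p v) < m v"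
  obtains f where "\<And>v. v \<in> R \<Longrightarrow> f v = v" "\<And>v. v \<in> V - R \<Longrightarrow> f v = f (p v)"
    "\<And>v. v \<in> V \<Longrightarrow> f v \<in> R"
proof -
  define k where "k v = (LEAST k. (p ^^ k) v \<in> R)" for v
  have ex: "\<exists>k. (p ^^ k) v \<in> R" if "v \<in> V" for v
    using that
  proof (induction "m v" arbitrary: v rule: less_induct)
    case less
    show ?case
    proof (cases "v \<in> R")
      case True
      then have "(p ^^ 0) v \<in> R" by simp
      then show ?thesis by blast
    next
      case False
      then obtain k where "(p ^^ k) (p v) \<in> R"
        using less.hyps[of "p v"] less.prems p[of v] by blast
      then have "(p ^^ Suc k) v \<in> R" by (simp add: funpow_swap1)
      then show ?thesis by blast
    qed
  qed
  have "(p ^^ k v) v \<in> R" if "v \<in> V" for v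
    using LeastI_ex[OF ex[OF that]] by (simp add: k_def)
  moreover have "(p ^^ k v) v = v" if "v \<in> R" for v
    using that by (simp add: k_def Least_eq_0)
  moreover have "(p ^^ k v) v = (p ^^ k (p v)) (p v)" if v: "v \<in> V - R" for v
  proof -
    obtain j where "(p ^^ j) v \<in> R" using ex v by blast
    \<comment> \<open>Iterate number 0 is \<open>v\<close> itself, no terminal, so the count from
      \<open>v\<close> is one more than the count from \<open>p v\<close>.\<close>
    then have "k v = Suc (LEAST i. (p ^^ Suc i) v \<in> R)"
      unfolding k_def using v by (intro Least_Suc) auto
    also have "\<dots> = Suc (k (p v))" by (simp add: k_def funpow_swap1)
    finally show ?thesis by (simp add: funpow_swap1)
  qed
  ultimately show ?thesis using that[of "\<lambda>v. (p ^^ k v) v"] by blast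
qed

text \<open>On \<open>vertices T\<close> these conditions force \<open>f\<close> to send a vertex to
  its nearest terminal ancestor. Elsewhere \<open>f\<close> is free, so one map on \<open>G\<close>
  can serve both trees.\<close>

locale projected_tree = rooted_tree T r par pe d
  for T :: "('v, 'e) pre_multigraph" and r par pe d +
  fixes G :: "('v, 'e) pre_multigraph" and R :: "'v set" and f :: "'v \<Rightarrow> 'v"
  assumes subgraph: "mg_subgraph T G"
    and terminals: "R \<subseteq> vertices T" and root_terminal: "r \<in> R"
    and f_terminal: "t \<in> R \<Longrightarrow> f t = t"
    and f_par: "v \<in> vertices T \<Longrightarrow> v \<notin> R \<Longrightarrow> f v = f (par v)"
begin

lemma f_ancestor: "v \<in> vertices T \<Longrightarrow> f v \<in> R \<and> d (f v) \<le> d v"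
proof (induction "d v" arbitrary: v rule: less_induct)
  case less
  show ?case
  proof (cases "v \<in> R")
    case False
    then have "v \<noteq> r" using root_terminal by auto
    with False less show ?thesis
      using f_par depth_par par_vertex by (metis le_trans less_imp_le)
  qed (simp add: f_terminal)
qed

text \<open>The last vertex before \<open>f v\<close> on the way up from \<open>v\<close> is such a
  child.\<close>

lemma f_has_child:
  "v \<in> vertices T \<Longrightarrow> v \<notin> R \<Longrightarrow> \<exists>x\<in>vertices T. x \<noteq> r \<and> par x = f v"
proof (induction "d v" arbitrary: v rule: less_induct)
  case less
  then have v: "v \<noteq> r" using root_terminal by auto
  show ?case
  proof (cases "par v \<in> R")
    case True
    with less v show ?thesis by (metis f_par f_terminal)
  next
    case False
    with less v show ?thesis by (metis f_par depth_par par_vertex)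
  qed
qed

lemma f_par_terminal:
  assumes "t \<in> R" "t \<noteq> r"
  shows "f (par t) \<in> R" "d (f (par t)) < d t"
  using assms terminals f_ancestor[of "par t"] par_vertex[of t] depth_par[of t] by auto

lemma in_fibre_iff: "t \<in> R \<Longrightarrow> s \<in> R \<Longrightarrow> s \<in> fibre G f t \<longleftrightarrow> s = t"
  using terminals subgraph by (auto simp: fibre_def f_terminal mg_subgraph_def)

lemma fibre_eq_iff: "t \<in> R \<Longrightarrow> s \<in> R \<Longrightarrow> fibre G f t = fibre G f s \<longleftrightarrow> t = s"
  using in_fibre_iff by blast

lemma inj_on_fibre: "inj_on (fibre G f) R"
  by (simp add: inj_on_def fibre_eq_iff)

text \<open>The edge \<open>pe v\<close> of a nonterminal \<open>v\<close> lies within one fibre.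
  For a terminal \<open>t\<close> other than the root, \<open>pe t\<close> ends at \<open>t\<close>
  itself, which makes the fibre of \<open>t\<close> a legitimate head.\<close>

definition minor_arc :: "'v \<Rightarrow> 'e \<times> 'v set \<times> 'v set" where
  "minor_arc t = (pe t, fibre G f (f (par t)), fibre G f t)"

definition minor_tree :: "('v set, 'e \<times> 'v set \<times> 'v set) pre_digraph" where
  "minor_tree = \<lparr>verts = fibre G f ` R, arcs = minor_arc ` (R - {r}),
     tail = (\<lambda>(e, X, Y). X), head = (\<lambda>(e, X, Y). Y)\<rparr>"

lemma finite_terminals: "finite R"
  using terminals finite_vertices finite_subset by blast

text \<open>A fibre stands for its terminal, recovered by \<open>inv_into\<close>, and inherits the
  \<open>d\<close> of that terminal, which drops by \<open>f_par_terminal\<close>. Acyclicity of the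
  contracted tree then comes from \<open>mg_tree\<close>.\<close>

lemma rooted_minor_tree:
  "rooted_tree (underlying minor_tree) (fibre G f r)
     (\<lambda>X. fibre G f (f (par (inv_into R (fibre G f) X))))
     (\<lambda>X. minor_arc (inv_into R (fibre G f) X)) (\<lambda>X. d (inv_into R (fibre G f) X))"
proof unfold_locales
  note inv = inv_into_f_f[OF inj_on_fibre]
  let ?U = "underlying minor_tree"
  show "finite (vertices ?U)" "finite (edges ?U)"
    using finite_terminals by (simp_all add: underlying_def minor_tree_def)
  show "ends ?U e \<subseteq> vertices ?U" if "e \<in> edges ?U" for e
    using that f_par_terminal by (auto simp: underlying_def minor_tree_def minor_arc_def)
  show "card (ends ?U e) = 2" if "e \<in> edges ?U" for e
  proof -
    obtain t where t: "t \<in> R" "t \<noteq> r" "e = minor_arc t"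
      using \<open>e \<in> edges ?U\<close> by (auto simp: underlying_def minor_tree_def)
    have "fibre G f (f (par t)) \<noteq> fibre G f t"
      using fibre_eq_iff f_par_terminal t by (metis less_irrefl)
    then show ?thesis using t by (simp add: underlying_def minor_tree_def minor_arc_def)
  qed
  show "fibre G f r \<in> vertices ?U"
    using root_terminal by (simp add: underlying_def minor_tree_def)
  have "vertices ?U - {fibre G f r} = fibre G f ` (R - {r})"
    using root_terminal by (auto simp: underlying_def minor_tree_def fibre_eq_iff)
  then show "edges ?U =
      (\<lambda>X. minor_arc (inv_into R (fibre G f) X)) ` (vertices ?U - {fibre G f r})"
    by (simp add: underlying_def minor_tree_def image_image inv)
  fix X assume "X \<in> vertices ?U" "X \<noteq> fibre G f r"
  then obtain t where t: "t \<in> R" "t \<noteq> r" "X = fibre G f t"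
    by (auto simp: underlying_def minor_tree_def)
  show "fibre G f (f (par (inv_into R (fibre G f) X))) \<in> vertices ?U"
    using t f_par_terminal by (auto simp: inv underlying_def minor_tree_def)
  show "d (inv_into R (fibre G f) (fibre G f (f (par (inv_into R (fibre G f) X)))))
      < d (inv_into R (fibre G f) X)"
    using t f_par_terminal by (simp add: inv)
  show "ends ?U (minor_arc (inv_into R (fibre G f) X)) =
      {X, fibre G f (f (par (inv_into R (fibre G f) X)))}"
    using t by (auto simp: inv underlying_def minor_tree_def minor_arc_def)
qed

lemma arborescence_minor_tree: "arborescence minor_tree"
  unfolding arborescence_def
proof (intro conjI bexI ballI)
  show "mg_tree (underlying minor_tree)" using rooted_tree.mg_tree[OF rooted_minor_tree] .
  show "fibre G f r \<in> verts minor_tree" using root_terminal by (simp add: minor_tree_def)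
  have "in_arcs minor_tree (fibre G f r) = {}"
    using root_terminal by (auto simp: in_arcs_def minor_tree_def minor_arc_def fibre_eq_iff)
  then show "in_degree minor_tree (fibre G f r) = 0" by (simp add: in_degree_def)
  fix X assume "X \<in> verts minor_tree - {fibre G f r}"
  then obtain t where t: "t \<in> R" "t \<noteq> r" "X = fibre G f t"
    by (auto simp: minor_tree_def)
  then have "in_arcs minor_tree X = {minor_arc t}"
    by (auto simp: in_arcs_def minor_tree_def minor_arc_def fibre_eq_iff)
  then show "in_degree minor_tree X = 1" by (simp add: in_degree_def)
qed

lemma spanning_minor_tree: "spanning minor_tree (induced_directed_minor G R (fibre G f ` R))"
proof -
  have "minor_arc t \<in> arcs (induced_directed_minor G R (fibre G f ` R))"
    if t: "t \<in> R" "t \<noteq> r" for t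
  proof -
    have tV: "t \<in> vertices T" using t terminals by auto
    have sub: "vertices T \<subseteq> vertices G" "edges T \<subseteq> edges G" "ends T = ends G"
      using subgraph by (auto simp: mg_subgraph_def)
    have "fibre G f (f (par t)) \<noteq> fibre G f t"
      using fibre_eq_iff f_par_terminal t by (metis less_irrefl)
    moreover have "pe t \<in> edges G" "ends G (pe t) = {par t, t}"
      using pe_edge ends_pe tV t sub by auto
    moreover have "par t \<in> fibre G f (f (par t))" "t \<in> fibre G f t"
      using par_vertex tV t sub in_fibre_iff by (auto simp: fibre_def)
    ultimately show ?thesis using t f_par_terminal
      unfolding induced_directed_minor_def minor_arc_def by auto
  qed
  then have "arcs minor_tree \<subseteq> arcs (induced_directed_minor G R (fibre G f ` R))"
    unfolding minor_tree_def by (simp add: image_subset_iff)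
  moreover have "wf_digraph (induced_directed_minor G R (fibre G f ` R))"
    by (auto simp: wf_digraph_def induced_directed_minor_def)
  moreover have "wf_digraph minor_tree"
    using f_par_terminal by (auto simp: wf_digraph_def minor_tree_def minor_arc_def)
  ultimately show ?thesis
    by (auto simp: spanning_def subgraph_def compatible_def minor_tree_def induced_directed_minor_def)
qed

text \<open>Away from the root, an arc at the fibre of \<open>t\<close> other than
  \<open>minor_arc t\<close> goes out of it, so \<open>t\<close> has a child in \<open>T\<close>
  besides its parent edge. The root is an exception: a single child of \<open>r\<close> in
  \<open>T\<close> can give rise to several arcs.\<close>

lemma int_minor_tree:
  "int_verts (underlying minor_tree) \<subseteq> fibre G f ` (R \<inter> (int_verts T \<union> {r}))"
proof
  fix X assume X: "X \<in> int_verts (underlying minor_tree)"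
  then obtain t where t: "t \<in> R" "X = fibre G f t"
    by (auto simp: int_verts_def underlying_def minor_tree_def)
  have "t \<in> int_verts T" if tr: "t \<noteq> r"
  proof -
    have tV: "t \<in> vertices T" using t terminals by auto
    let ?I = "{e \<in> edges (underlying minor_tree). X \<in> ends (underlying minor_tree) e}"
    have "\<not> ?I \<subseteq> {minor_arc t}"
      using X card_mono[of "{minor_arc t}" ?I] by (auto simp: int_verts_def mg_degree_def)
    then obtain s where s: "s \<in> R" "s \<noteq> r" "s \<noteq> t" "X \<in> {fibre G f (f (par s)), fibre G f s}"
      by (auto simp: underlying_def minor_tree_def minor_arc_def)
    then have fs: "f (par s) = t"
      using t f_par_terminal fibre_eq_iff by auto
    \<comment> \<open>If \<open>par s\<close> is a terminal, it equals \<open>t\<close> and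
      \<open>s\<close> is the child; otherwise \<open>f_has_child\<close> yields one.\<close>
    have "\<exists>x\<in>vertices T. x \<noteq> r \<and> par x = t"
    proof (cases "par s \<in> R")
      case True
      then show ?thesis using fs f_terminal s terminals by auto
    next
      case False
      then show ?thesis using fs f_has_child[of "par s"] par_vertex[of s] s terminals by auto
    qed
    then obtain x where x: "x \<in> vertices T" "x \<noteq> r" "par x = t" by blast
    then have "x \<noteq> t" using depth_par[of x] by auto
    then have "pe x \<noteq> pe t" using inj_on_pe x tV tr by (auto dest: inj_onD)
    then show ?thesis
      using card_incident_ge[of "pe x" "pe t" t] pe_edge ends_pe x tV tr
      by (simp add: int_verts_def)
  qed
  then show "X \<in> fibre G f ` (R \<inter> (int_verts T \<union> {r}))" using t by blast
qed

end

text \<open>Since \<open>f v = f (p v)\<close>, following \<open>p\<close> from a vertex stays in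
  its fibre and ends at the terminal there, so each fibre is connected.\<close>

lemma minor_partition_fibres:
  fixes m :: "'v \<Rightarrow> nat"
  assumes R: "R \<subseteq> vertices G" and fin: "finite R"
    and p: "\<And>v. v \<in> vertices G - R \<Longrightarrow> p v \<in> vertices G \<and> m (p v) < m v \<and>
           (\<exists>e\<in>edges G. ends G e = {v, p v})"
    and f: "\<And>v. v \<in> R \<Longrightarrow> f v = v" "\<And>v. v \<in> vertices G - R \<Longrightarrow> f v = f (p v)"
      "\<And>v. v \<in> vertices G \<Longrightarrow> f v \<in> R"
  shows "minor_partition G R (fibre G f ` R)"
  unfolding minor_partition_def
proof (intro conjI ballI)
  have self: "t \<in> fibre G f t" if "t \<in> R" for t
    using that R f(1) by (auto simp: fibre_def)
  show "partition_on (vertices G) (fibre G f ` R)"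
  proof (rule partition_onI)
    show "\<Union> (fibre G f ` R) = vertices G" using f(3) by (auto simp: fibre_def)
    show "{} \<notin> fibre G f ` R" using self by blast
  qed (auto simp: fibre_def disjnt_def)
  have "inj_on (fibre G f) R"
    using self by (force simp: inj_on_def fibre_def)
  then show "card (fibre G f ` R) = card R" by (rule card_image)
  fix X assume "X \<in> fibre G f ` R"
  then obtain t where t: "t \<in> R" "X = fibre G f t" by blast
  then have "X \<inter> R = {t}" using self f(1) by (auto simp: fibre_def)
  then show "card (X \<inter> R) = 1" by simp
  let ?H = "mg_induced G X"
  have tH: "t \<in> vertices ?H" using self t by (simp add: mg_induced_def)
  show "mg_connected ?H"
  proof (rule mg_connectedI[OF tH])
    show "\<exists>q. mg_walk ?H v q t" if v: "v \<in> vertices ?H" for v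
    proof (rule parent_walk[OF tH _ v, of p m])
      fix v assume "v \<in> vertices ?H - {t}"
      then have v: "v \<in> vertices G - R" "f v = t"
        using t f(1) by (auto simp: mg_induced_def fibre_def)
      then have "p v \<in> vertices G" "m (p v) < m v" "f (p v) = t"
        using p f(2) by auto
      moreover obtain e where "e \<in> edges G" "ends G e = {v, p v}" using p v by blast
      ultimately show "p v \<in> vertices ?H \<and> m (p v) < m v \<and>
          (\<exists>e\<in>edges ?H. ends ?H e = {v, p v})"
        using v t by (auto simp: mg_induced_def fibre_def)
    qed
  qed
qed

theorem theorem3p27:
  fixes G :: "('v, 'e) pre_multigraph" and R :: "'v set"
  assumes "multigraph G" and "mg_connected G"
    and "R \<subseteq> vertices G" and "card R \<ge> 2"
    and "has_CIST G R 2"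
  shows "\<exists>D. directed_minor G R D \<and> has_CISA D 2"
proof -
  have R: "finite R" "R \<noteq> {}" using assms(4) card.infinite by fastforce+
  obtain S T where ST: "CIST G R {S, T}" "S \<noteq> T"
    using assms(5) by (auto simp: has_CIST_def card_2_iff)
  then have S: "steiner_tree G R S" and T: "steiner_tree G R T" by (auto simp: CIST_def)
  note S' = steiner_treeD[OF S] and T' = steiner_treeD[OF T]
  have edges: "edges S \<inter> edges T = {}" by (rule CIST_edges_disjoint[OF ST R(2)])
  have int: "int_verts S \<inter> int_verts T = {}" by (rule CIST_int_disjoint[OF ST assms(4)])
  have verts: "vertices S \<inter> vertices T \<subseteq> R"
    using int steiner_nonterminal_int[OF S R(2)] steiner_nonterminal_int[OF T R(2)] by blast
  obtain r2 where r2: "r2 \<in> R" "r2 \<notin> int_verts S"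
    using steiner_other_leaf[OF S assms(4)] R(2) S'(4) by blast
  obtain r1 where r1: "r1 \<in> R" "r1 \<notin> int_verts T" "r1 \<noteq> r2"
    using steiner_other_leaf[OF T assms(4), of r2] r2 T'(4) by blast
  obtain par1 pe1 d1 where "rooted_tree S r1 par1 pe1 d1"
    using mg_tree_rooted[OF S'(1), of r1] r1 S'(4) by blast
  then interpret S: rooted_tree S r1 par1 pe1 d1 .
  obtain par2 pe2 d2 where "rooted_tree T r2 par2 pe2 d2"
    using mg_tree_rooted[OF T'(1), of r2] r2 T'(4) by blast
  then interpret T: rooted_tree T r2 par2 pe2 d2 .
  \<comment> \<open>A search tree of all of \<open>G\<close>, for the vertices outside both Steiner
    trees.\<close>
  obtain par0 pe0 and d0 :: "'v \<Rightarrow> nat" where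
    parents: "\<forall>v\<in>vertices G - {r1}. par0 v \<in> vertices G \<and> d0 (par0 v) < d0 v \<and>
        pe0 v \<in> edges G \<and> ends G (pe0 v) = {v, par0 v}"
    using mg_connected_parents[OF assms(2) subsetD[OF assms(3) r1(1)]] by blast
  have subS: "vertices S \<subseteq> vertices G" "edges S \<subseteq> edges G" "ends S = ends G"
    and subT: "vertices T \<subseteq> vertices G" "edges T \<subseteq> edges G" "ends T = ends G"
    using S'(3) T'(3) by (auto simp: mg_subgraph_def)

  \<comment> \<open>Only terminals lie in both trees, and \<open>f\<close> fixes these, so the order
    of the cases does not affect \<open>f\<close>.\<close>
  define p where "p v = (if v \<in> vertices S then par1 v
    else if v \<in> vertices T then par2 v else par0 v)" for v
  \<comment> \<open>\<open>M\<close> bounds \<open>d1\<close> and \<open>d2\<close> on the trees;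
    the offset \<open>Suc M\<close> ranks an outside vertex above any tree vertex that
    \<open>par0\<close> may reach.\<close>
  define M where "M = Max (d1 ` vertices S \<union> d2 ` vertices T)"
  have M: "d1 v \<le> M" if "v \<in> vertices S" for v
    using that S.finite_vertices T.finite_vertices by (simp add: M_def)
  have M': "d2 v \<le> M" if "v \<in> vertices T" for v
    using that S.finite_vertices T.finite_vertices by (simp add: M_def)
  \<comment> \<open>Terminals get rank 0, as a terminal reached inside T has no small depth in S.\<close>
  define m where "m v = (if v \<in> R then 0 else if v \<in> vertices S then d1 v
    else if v \<in> vertices T then d2 v else Suc M + d0 v)" for v
  have p: "p v \<in> vertices G \<and> m (p v) < m v \<and> (\<exists>e\<in>edges G. ends G e = {v, p v})"
    if v: "v \<in> vertices G - R" for v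
  proof -
    have ne: "v \<noteq> r1" "v \<noteq> r2" using v r1 r2 by auto
    consider (S) "v \<in> vertices S" | (T) "v \<in> vertices T" "v \<notin> vertices S"
      | (G) "v \<notin> vertices S" "v \<notin> vertices T" by blast
    then show ?thesis
    proof cases
      case S
      then have "par1 v \<in> vertices S" "d1 (par1 v) < d1 v" "pe1 v \<in> edges G"
          "ends G (pe1 v) = {v, par1 v}"
        using S.par_vertex S.depth_par S.pe_edge S.ends_pe ne subS by auto
      with S v subS show ?thesis by (auto simp: p_def m_def)
    next
      case T
      then have "par2 v \<in> vertices T" "d2 (par2 v) < d2 v" "pe2 v \<in> edges G"
          "ends G (pe2 v) = {v, par2 v}"
        using T.par_vertex T.depth_par T.pe_edge T.ends_pe ne subT by auto
      with T v subT verts show ?thesis by (auto simp: p_def m_def)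
    next
      case G
      then show ?thesis
        using bspec[OF parents, of v] v ne M[of "par0 v"] M'[of "par0 v"]
        by (auto simp: p_def m_def)
    qed
  qed
  obtain f where f: "\<And>v. v \<in> R \<Longrightarrow> f v = v" "\<And>v. v \<in> vertices G - R \<Longrightarrow> f v = f (p v)"
      "\<And>v. v \<in> vertices G \<Longrightarrow> f v \<in> R"
    using exists_projection[of "vertices G" R p m] p by blast
  have f_par1: "f v = f (par1 v)" if "v \<in> vertices S" "v \<notin> R" for v
    using f(2)[of v] that subS by (auto simp: p_def)
  have f_par2: "f v = f (par2 v)" if "v \<in> vertices T" "v \<notin> R" for v
  proof -
    have "v \<in> vertices G - R" "v \<notin> vertices S" using that subT verts by auto
    then show ?thesis using f(2)[of v] that by (simp add: p_def)
  qed
  interpret A: projected_tree S r1 par1 pe1 d1 G R f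
    using S' r1 f(1) f_par1 by unfold_locales auto
  interpret B: projected_tree T r2 par2 pe2 d2 G R f
    using T' r2 f(1) f_par2 by unfold_locales auto

  define D where "D = induced_directed_minor G R (fibre G f ` R)"
  have "directed_minor G R D"
    unfolding directed_minor_def D_def
    using minor_partition_fibres[OF assms(3) R(1) p f] by blast
  moreover have "has_CISA D 2"
  proof -
    have arcs: "arcs A.minor_tree \<inter> arcs B.minor_tree = {}"
    proof -
      have "pe1 t \<noteq> pe2 s" if "t \<in> R - {r1}" "s \<in> R - {r2}" for s t
      proof -
        have "t \<in> vertices S" "s \<in> vertices T" using that S'(4) T'(4) by auto
        then have "pe1 t \<in> edges S" "pe2 s \<in> edges T"
          using S.pe_edge T.pe_edge that by auto
        then show ?thesis using edges by auto
      qed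
      then show ?thesis
        by (auto simp: A.minor_tree_def B.minor_tree_def A.minor_arc_def B.minor_arc_def)
    qed
    \<comment> \<open>\<open>r2\<close> contributes an arc to the first tree, so disjoint arc sets
      force two different arborescences, as size 2 demands.\<close>
    have "arcs A.minor_tree \<noteq> {}" using r1 r2 by (auto simp: A.minor_tree_def)
    then have "A.minor_tree \<noteq> B.minor_tree" using arcs by auto
    moreover have "int_verts (underlying A.minor_tree) \<inter> int_verts (underlying B.minor_tree) = {}"
    proof -
      \<comment> \<open>The underlying sets of terminals are disjoint by the choice of the roots:
        neither is inner in the other tree, and they differ. Fibres of distinct terminals are
        distinct.\<close>
      have "fibre G f ` (R \<inter> (int_verts S \<union> {r1})) \<inter> fibre G f ` (R \<inter> (int_verts T \<union> {r2})) = {}"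
        using int r1 r2 by (auto simp: A.fibre_eq_iff)
      moreover note Int_mono[OF A.int_minor_tree B.int_minor_tree]
      ultimately show ?thesis by simp
    qed
    ultimately have "CISA D {A.minor_tree, B.minor_tree}"
      using arcs A.arborescence_minor_tree B.arborescence_minor_tree
        A.spanning_minor_tree B.spanning_minor_tree
      unfolding CISA_def D_def by (simp add: Int_commute)
    then show ?thesis
      using \<open>A.minor_tree \<noteq> B.minor_tree\<close> unfolding has_CISA_def
      by (intro exI[of _ "{A.minor_tree, B.minor_tree}"]) auto
  qed
  ultimately show ?thesis by blast
qed

end
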